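(* Let $n\ge 2$ and $sl_n=sl_n(\mathbf{C})$. For the adjoint representation $\mathrm{ad}: sl_n\to \mathrm{End}(sl_n)$ one has $$\mathrm{ad}=2n\,\eta\circ(\mathrm{id}_{sl_n}\otimes B^{-1})\circ\delta,$$ where $\delta:sl_n\to sl_n\otimes sl_n$, $B:(sl_n)^*\to sl_n$ and $\eta:sl_n\otimes(sl_n)^*\to\mathrm{End}(sl_n)$ are the maps defined in the context.
   Context: $E_{i,j}$ denotes the matrix units in $gl_n=gl_n(\mathbf{C})$, and $sl_n$ carries the commutator bracket. The map $\delta: sl_n\to sl_n\otimes sl_n$ is the restriction to $sl_n$ of the linear map on $gl_n$ given by $$\delta(E_{i,j})=\frac{1}{2n}\sum_{k=1}^{n}\left(E_{i,k}\otimes E_{k,j}-E_{k,j}\otimes E_{i,k}\right);$$ this restriction takes values in $sl_n\otimes sl_n$. Let $\{f_{i,j}\}_{1\le i,j\le n}$ be the basis of $(gl_n)^*$ with $f_{i,j}(E_{k,l})=\delta_{i,k}\delta_{j,l}$ (Kronecker deltas). The space $(sl_n)^*$ is regarded as a subspace of $(gl_n)^*$ by extending each functional on $sl_n$ to $gl_n=sl_n\oplus\mathbf{C}I$ by zero on the identity matrix $I$, and $B:(sl_n)^*\to sl_n$ is the linear isomorphism obtained by restricting the linear map $(gl_n)^*\to gl_n$, $f_{i,j}\mapsto E_{j,i}$. The map $\eta: sl_n\otimes(sl_n)^*\to\mathrm{End}(sl_n)$ is the isomorphism $\eta(x\otimes f)(y)=f(y)x$. *)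

theory Defs
  imports "HOL-Analysis.Analysis" "HOL-Library.Poly_Mapping"
begin

text \<open>
  The library only has a type class for real vector spaces; complex scalar multiplication is
  needed since the tensor products and duals are taken over \<open>\<complex>\<close>.
\<close>

class complex_vector = ab_group_add +
  fixes scaleC :: "complex \<Rightarrow> 'a \<Rightarrow> 'a"  (infixr "*\<^sub>C" 75)
  assumes scaleC_add_right: "a *\<^sub>C (x + y) = a *\<^sub>C x + a *\<^sub>C y"
    and scaleC_add_left: "(a + b) *\<^sub>C x = a *\<^sub>C x + b *\<^sub>C x"
    and scaleC_scaleC: "a *\<^sub>C b *\<^sub>C x = (a * b) *\<^sub>C x"
    and scaleC_one: "1 *\<^sub>C x = x"

global_interpretation complex_vector: vector_space "scaleC :: complex \<Rightarrow> 'a \<Rightarrow> 'a::complex_vector"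
  by unfold_locales (simp_all add: scaleC_add_right scaleC_add_left scaleC_scaleC scaleC_one)

abbreviation clinear :: "('a::complex_vector \<Rightarrow> 'b::complex_vector) \<Rightarrow> bool"
  where "clinear f \<equiv> Vector_Spaces.linear scaleC scaleC f"

lemma clinear_iff:
  "clinear f \<longleftrightarrow> (\<forall>x y. f (x + y) = f x + f y) \<and> (\<forall>c x. f (c *\<^sub>C x) = c *\<^sub>C f x)"
  by (auto simp: Vector_Spaces.linear_def module_hom_def module_hom_axioms_def
      complex_vector.vector_space_axioms complex_vector.module_axioms)

lemma clinearI:
  assumes "\<And>x y. f (x + y) = f x + f y" "\<And>c x. f (c *\<^sub>C x) = c *\<^sub>C f x"
  shows "clinear f"
  using assms by (auto simp: clinear_iff)

lemma clinear_add: "clinear f \<Longrightarrow> f (x + y) = f x + f y"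
  and clinear_scale: "clinear f \<Longrightarrow> f (c *\<^sub>C x) = c *\<^sub>C f x"
  by (auto simp: clinear_iff)

lemma clinear_0: "clinear f \<Longrightarrow> f 0 = 0"
  using clinear_scale[of f 0 0] by simp

lemma clinear_diff: "clinear f \<Longrightarrow> f (x - y) = f x - f y"
  using clinear_add[of f "x - y" y] by simp

lemma clinear_sum: "clinear f \<Longrightarrow> f (sum g A) = (\<Sum>x\<in>A. f (g x))"
  by (induction A rule: infinite_finite_induct) (simp_all add: clinear_0 clinear_add)

lemma clinear_compose: "clinear f \<Longrightarrow> clinear g \<Longrightarrow> clinear (\<lambda>x. f (g x))"
  by (simp add: clinear_iff)

instantiation complex :: complex_vector
begin
definition scaleC_complex :: "complex \<Rightarrow> complex \<Rightarrow> complex" where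
  "scaleC_complex c x = c * x"
instance by standard (simp_all add: scaleC_complex_def algebra_simps)
end

instantiation vec :: (complex_vector, finite) complex_vector
begin
definition scaleC_vec :: "complex \<Rightarrow> 'a^'b \<Rightarrow> 'a^'b" where
  "scaleC_vec c x = (\<chi> i. c *\<^sub>C x $ i)"
instance by standard
  (simp_all add: scaleC_vec_def vec_eq_iff scaleC_add_right scaleC_add_left scaleC_scaleC scaleC_one)
end

instantiation poly_mapping :: (type, complex_vector) complex_vector
begin
lift_definition scaleC_poly_mapping :: "complex \<Rightarrow> ('a \<Rightarrow>\<^sub>0 'b) \<Rightarrow> ('a \<Rightarrow>\<^sub>0 'b)"
  is "\<lambda>c p k. c *\<^sub>C p k"
  by (erule finite_subset[rotated]) auto
instance by (standard; transfer)
  (simp_all add: fun_eq_iff scaleC_add_right scaleC_add_left scaleC_scaleC scaleC_one)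
end

typedef (overloaded) ('a, 'b) linmap =
  "{f :: 'a::complex_vector \<Rightarrow> 'b::complex_vector. clinear f}"
  morphisms lin_apply Abs_linmap
  by (rule exI[of _ "\<lambda>_. 0"]) (simp add: clinear_iff)

setup_lifting type_definition_linmap

instantiation linmap :: (complex_vector, complex_vector) complex_vector
begin
lift_definition zero_linmap :: "('a, 'b) linmap" is "\<lambda>_. 0"
  by (simp add: clinear_iff)
lift_definition plus_linmap :: "('a, 'b) linmap \<Rightarrow> ('a, 'b) linmap \<Rightarrow> ('a, 'b) linmap"
  is "\<lambda>f g x. f x + g x"
  by (auto simp: clinear_iff scaleC_add_right)
lift_definition minus_linmap :: "('a, 'b) linmap \<Rightarrow> ('a, 'b) linmap \<Rightarrow> ('a, 'b) linmap"
  is "\<lambda>f g x. f x - g x"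
  by (auto simp: clinear_iff complex_vector.scale_right_diff_distrib)
lift_definition uminus_linmap :: "('a, 'b) linmap \<Rightarrow> ('a, 'b) linmap"
  is "\<lambda>f x. - f x"
  by (auto simp: clinear_iff)
lift_definition scaleC_linmap :: "complex \<Rightarrow> ('a, 'b) linmap \<Rightarrow> ('a, 'b) linmap"
  is "\<lambda>c f x. c *\<^sub>C f x"
  by (auto simp: clinear_iff scaleC_add_right scaleC_scaleC mult.commute)
instance by (standard; transfer)
  (simp_all add: fun_eq_iff scaleC_add_right scaleC_add_left scaleC_scaleC scaleC_one algebra_simps)
end

type_synonym 'a dual = "('a, complex) linmap"
type_synonym 'a endo = "('a, 'a) linmap"

lemma clinear_lin_apply: "clinear (lin_apply f)"
  using lin_apply by auto

definition tensor_relators :: "(('a::complex_vector \<times> 'b::complex_vector) \<Rightarrow>\<^sub>0 complex) set" where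
  "tensor_relators =
     {Poly_Mapping.single (a + a', b) 1 - Poly_Mapping.single (a, b) 1
        - Poly_Mapping.single (a', b) 1 | a a' b. True}
   \<union> {Poly_Mapping.single (a, b + b') 1 - Poly_Mapping.single (a, b) 1
        - Poly_Mapping.single (a, b') 1 | a b b'. True}
   \<union> {Poly_Mapping.single (c *\<^sub>C a, b) 1 - c *\<^sub>C Poly_Mapping.single (a, b) 1 | a b c. True}
   \<union> {Poly_Mapping.single (a, c *\<^sub>C b) 1 - c *\<^sub>C Poly_Mapping.single (a, b) 1 | a b c. True}"

definition tensor_rel ::
  "(('a::complex_vector \<times> 'b::complex_vector) \<Rightarrow>\<^sub>0 complex) \<Rightarrow> (('a \<times> 'b) \<Rightarrow>\<^sub>0 complex) \<Rightarrow> bool" where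
  "tensor_rel p q \<longleftrightarrow> p - q \<in> complex_vector.span tensor_relators"

lemma equivp_tensor_rel: "equivp tensor_rel"
proof (rule equivpI)
  show "reflp tensor_rel"
    by (simp add: reflp_def tensor_rel_def complex_vector.span_zero)
  show "symp tensor_rel"
    unfolding symp_def tensor_rel_def by (metis complex_vector.span_neg minus_diff_eq)
  show "transp tensor_rel"
    using complex_vector.span_add[of "p - q" tensor_relators "q - r" for p q r]
    by (auto simp: transp_def tensor_rel_def)
qed

quotient_type (overloaded) ('a, 'b) tensor =
    "('a::complex_vector \<times> 'b::complex_vector) \<Rightarrow>\<^sub>0 complex" / tensor_rel
  by (rule equivp_tensor_rel)

instantiation tensor :: (complex_vector, complex_vector) complex_vector
begin
lift_definition zero_tensor :: "('a, 'b) tensor" is 0 .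
lift_definition plus_tensor :: "('a, 'b) tensor \<Rightarrow> ('a, 'b) tensor \<Rightarrow> ('a, 'b) tensor" is "(+)"
  unfolding tensor_rel_def using complex_vector.span_add by (metis add_diff_add)
lift_definition minus_tensor :: "('a, 'b) tensor \<Rightarrow> ('a, 'b) tensor \<Rightarrow> ('a, 'b) tensor" is "(-)"
  unfolding tensor_rel_def subgoal for p p' q q'
    using complex_vector.span_diff[of "p - p'" tensor_relators "q - q'"]
    by (simp add: algebra_simps)
  done
lift_definition uminus_tensor :: "('a, 'b) tensor \<Rightarrow> ('a, 'b) tensor" is uminus
  unfolding tensor_rel_def subgoal for p q
    using complex_vector.span_neg[of "p - q" tensor_relators] by simp
  done
lift_definition scaleC_tensor :: "complex \<Rightarrow> ('a, 'b) tensor \<Rightarrow> ('a, 'b) tensor" is scaleC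
  unfolding tensor_rel_def
  by (metis complex_vector.span_scale complex_vector.scale_right_diff_distrib)
instance
proof (standard; transfer)
qed (simp_all add: tensor_rel_def complex_vector.span_zero scaleC_add_right scaleC_add_left
      scaleC_scaleC scaleC_one)
end

lift_definition tensor :: "'a::complex_vector \<Rightarrow> 'b::complex_vector \<Rightarrow> ('a, 'b) tensor"  (infixr "\<otimes>" 76)
  is "\<lambda>a b. Poly_Mapping.single (a, b) 1" .

definition cbilinear ::
  "('a::complex_vector \<Rightarrow> 'b::complex_vector \<Rightarrow> 'c::complex_vector) \<Rightarrow> bool" where
  "cbilinear h \<longleftrightarrow> (\<forall>a. clinear (h a)) \<and> (\<forall>b. clinear (\<lambda>a. h a b))"

text \<open>
  Meaningful for bilinear \<open>h\<close> only (and \<open>tensor_map\<close> for linear maps only), where existence and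
  uniqueness are given by \<open>tensor_lift_ex\<close> and \<open>tensor_ext\<close>.
\<close>

definition tensor_lift ::
  "('a::complex_vector \<Rightarrow> 'b::complex_vector \<Rightarrow> 'c::complex_vector) \<Rightarrow> ('a, 'b) tensor \<Rightarrow> 'c" where
  "tensor_lift h = (THE F. clinear F \<and> (\<forall>a b. F (a \<otimes> b) = h a b))"

definition tensor_map ::
  "('a::complex_vector \<Rightarrow> 'c::complex_vector) \<Rightarrow> ('b::complex_vector \<Rightarrow> 'd::complex_vector)
    \<Rightarrow> ('a, 'b) tensor \<Rightarrow> ('c, 'd) tensor" where
  "tensor_map f g = tensor_lift (\<lambda>a b. f a \<otimes> g b)"

lemma cbilinear_tensor: "cbilinear (\<otimes>)"
  unfolding cbilinear_def clinear_iff
proof (intro conjI allI; transfer)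
  fix a a' :: 'a and b b' :: 'b and c :: complex
  have base: "p \<in> tensor_relators \<Longrightarrow> p \<in> complex_vector.span tensor_relators"
    for p :: "('a \<times> 'b) \<Rightarrow>\<^sub>0 complex"
    by (rule complex_vector.span_base)
  show "tensor_rel (Poly_Mapping.single (a, b + b') 1)
      (Poly_Mapping.single (a, b) 1 + Poly_Mapping.single (a, b') 1)"
    unfolding tensor_rel_def diff_diff_eq[symmetric] by (rule base) (unfold tensor_relators_def, blast)
  show "tensor_rel (Poly_Mapping.single (a + a', b) 1)
      (Poly_Mapping.single (a, b) 1 + Poly_Mapping.single (a', b) 1)"
    unfolding tensor_rel_def diff_diff_eq[symmetric] by (rule base) (unfold tensor_relators_def, blast)
  show "tensor_rel (Poly_Mapping.single (a, c *\<^sub>C b) 1) (c *\<^sub>C Poly_Mapping.single (a, b) 1)"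
    unfolding tensor_rel_def by (rule base) (unfold tensor_relators_def, blast)
  show "tensor_rel (Poly_Mapping.single (c *\<^sub>C a, b) 1) (c *\<^sub>C Poly_Mapping.single (a, b) 1)"
    unfolding tensor_rel_def by (rule base) (unfold tensor_relators_def, blast)
qed

lemma poly_mapping_expand:
  fixes p :: "'k \<Rightarrow>\<^sub>0 complex"
  shows "p = (\<Sum>k\<in>Poly_Mapping.keys p. Poly_Mapping.lookup p k *\<^sub>C Poly_Mapping.single k 1)"
  by (rule poly_mapping_eqI)
    (simp add: lookup_sum scaleC_poly_mapping.rep_eq scaleC_complex_def lookup_single when_def
      if_distrib sum.delta in_keys_iff cong: if_cong)

lemma abs_tensor_cases: obtains p where "t = abs_tensor p"
  using Quotient3_abs_rep[OF Quotient3_tensor, of t] by metis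

lemma tensor_expand:
  obtains K :: "('a::complex_vector \<times> 'b::complex_vector) set" and u
  where "finite K" "t = (\<Sum>k\<in>K. u k *\<^sub>C (fst k \<otimes> snd k))"
proof -
  obtain p where t: "t = abs_tensor p"
    by (rule abs_tensor_cases)
  have *: "clinear (abs_tensor :: _ \<Rightarrow> ('a, 'b) tensor)"
    by (simp add: clinear_iff plus_tensor.abs_eq scaleC_tensor.abs_eq)
  have "t = (\<Sum>k\<in>Poly_Mapping.keys p. Poly_Mapping.lookup p k *\<^sub>C (fst k \<otimes> snd k))"
    unfolding t by (subst poly_mapping_expand[of p])
      (simp add: clinear_sum[OF *] clinear_scale[OF *] tensor.abs_eq)
  then show thesis
    using that finite_keys by blast
qed

lemma tensor_ext:
  assumes "clinear F" "clinear G" "\<And>a b. F (a \<otimes> b) = G (a \<otimes> b)"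
  shows "F t = G t"
proof -
  obtain K u where "finite K" "t = (\<Sum>k\<in>K. u k *\<^sub>C (fst k \<otimes> snd k))"
    by (rule tensor_expand)
  then show ?thesis
    using assms by (simp add: clinear_sum clinear_scale)
qed

lemma tensor_lift_ex:
  assumes h: "cbilinear h"
  shows "\<exists>F. clinear F \<and> (\<forall>a b. F (a \<otimes> b) = h a b)"
proof -
  define G where "G p = (\<Sum>k\<in>Poly_Mapping.keys p. Poly_Mapping.lookup p k *\<^sub>C h (fst k) (snd k))"
    for p :: "('a \<times> 'b) \<Rightarrow>\<^sub>0 complex"
  have G: "G p = (\<Sum>k\<in>K. Poly_Mapping.lookup p k *\<^sub>C h (fst k) (snd k))"
    if "finite K" "Poly_Mapping.keys p \<subseteq> K" for p K
    unfolding G_def using that by (intro sum.mono_neutral_left) (auto simp: in_keys_iff)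
  have lin: "clinear G"
  proof (rule clinearI)
    fix p q :: "('a \<times> 'b) \<Rightarrow>\<^sub>0 complex" and c
    let ?K = "Poly_Mapping.keys p \<union> Poly_Mapping.keys q"
    show "G (p + q) = G p + G q"
      using Poly_Mapping.keys_add[of p q]
      by (simp add: G[of ?K] lookup_add scaleC_add_left sum.distrib)
    have "Poly_Mapping.keys (c *\<^sub>C p) \<subseteq> Poly_Mapping.keys p"
      by (auto simp: in_keys_iff scaleC_poly_mapping.rep_eq scaleC_complex_def)
    then show "G (c *\<^sub>C p) = c *\<^sub>C G p"
      by (simp add: G[of "Poly_Mapping.keys p"] scaleC_poly_mapping.rep_eq scaleC_complex_def
          complex_vector.scale_sum_right scaleC_scaleC)
  qed
  have single: "G (Poly_Mapping.single (a, b) 1) = h a b" for a b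
    by (simp add: G_def scaleC_one)
  have h': "clinear (h a)" "clinear (\<lambda>a. h a b)" for a b
    using h by (auto simp: cbilinear_def)
  have relators: "G r = 0" if "r \<in> tensor_relators" for r
    using that unfolding tensor_relators_def
    by (auto simp: clinear_diff[OF lin] clinear_scale[OF lin] single clinear_add[OF h'(1)]
        clinear_scale[OF h'(1)] clinear_add[OF h'(2)] clinear_scale[OF h'(2)])
  have span: "G r = 0" if "r \<in> complex_vector.span tensor_relators" for r
    using that
  proof (induction rule: complex_vector.span_induct_alt)
    case base
    then show ?case by (rule clinear_0[OF lin])
  next
    case (step c x y)
    then show ?case
      by (simp add: relators clinear_add[OF lin] clinear_scale[OF lin])
  qed
  have resp: "G p = G q" if "tensor_rel p q" for p q
    using span[of "p - q"] that by (simp add: tensor_rel_def clinear_diff[OF lin])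
  define F where "F t = G (rep_tensor t)" for t
  have F: "F (abs_tensor p) = G p" for p
    unfolding F_def by (rule resp) (rule rep_abs_rsp_left[OF Quotient3_tensor equivp_reflp[OF equivp_tensor_rel]])
  have "clinear F"
  proof (rule clinearI)
    fix x y :: "('a, 'b) tensor" and c
    obtain p q where "x = abs_tensor p" "y = abs_tensor q" by (meson abs_tensor_cases)
    then show "F (x + y) = F x + F y" "F (c *\<^sub>C x) = c *\<^sub>C F x"
      by (simp_all add: plus_tensor.abs_eq scaleC_tensor.abs_eq F clinear_add[OF lin] clinear_scale[OF lin])
  qed
  then show ?thesis
    by (intro exI[of _ F]) (simp add: tensor.abs_eq F single)
qed

lemma tensor_lift:
  assumes "cbilinear h"
  shows clinear_tensor_lift: "clinear (tensor_lift h)"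
    and tensor_lift_tensor: "tensor_lift h (a \<otimes> b) = h a b"
proof -
  have "\<exists>!F. clinear F \<and> (\<forall>a b. F (a \<otimes> b) = h a b)"
  proof (rule ex_ex1I)
    show "\<exists>F. clinear F \<and> (\<forall>a b. F (a \<otimes> b) = h a b)"
      by (rule tensor_lift_ex[OF assms])
    show "F = G" if "clinear F \<and> (\<forall>a b. F (a \<otimes> b) = h a b)"
      "clinear G \<and> (\<forall>a b. G (a \<otimes> b) = h a b)" for F G
      by (rule ext, rule tensor_ext[of F G]) (simp_all add: that)
  qed
  then have *: "clinear (tensor_lift h) \<and> (\<forall>a b. tensor_lift h (a \<otimes> b) = h a b)"
    unfolding tensor_lift_def by (rule theI')
  show "clinear (tensor_lift h)" "tensor_lift h (a \<otimes> b) = h a b"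
    by (rule *[THEN conjunct1], rule *[THEN conjunct2, rule_format])
qed

lemmas clinear_tensor =
  cbilinear_tensor[unfolded cbilinear_def, THEN conjunct1, THEN spec]
  cbilinear_tensor[unfolded cbilinear_def, THEN conjunct2, THEN spec]

lemma cbilinear_tensor_map: "clinear f \<Longrightarrow> clinear g \<Longrightarrow> cbilinear (\<lambda>a b. f a \<otimes> g b)"
  unfolding cbilinear_def
  by (auto intro: clinear_compose[OF clinear_tensor(1)] clinear_compose[OF clinear_tensor(2)])

lemma tensor_map:
  assumes "clinear f" "clinear g"
  shows clinear_tensor_map: "clinear (tensor_map f g)"
    and tensor_map_tensor: "tensor_map f g (a \<otimes> b) = f a \<otimes> g b"
  unfolding tensor_map_def by (rule tensor_lift[OF cbilinear_tensor_map[OF assms]])+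

lift_definition rank_one :: "'a::complex_vector \<Rightarrow> 'a dual \<Rightarrow> 'a endo"
  is "\<lambda>x f y. f y *\<^sub>C x"
  by (auto simp: clinear_iff scaleC_add_left scaleC_scaleC scaleC_complex_def)

definition eta :: "('a::complex_vector, 'a dual) tensor \<Rightarrow> 'a endo" where
  "eta = tensor_lift rank_one"

lemma cbilinear_rank_one: "cbilinear rank_one"
  unfolding cbilinear_def clinear_iff
  by (intro conjI allI; transfer)
    (auto simp: fun_eq_iff scaleC_add_left scaleC_add_right scaleC_scaleC scaleC_complex_def mult.commute)

type_synonym 'n gl = "complex^'n^'n"

definition E :: "'n \<Rightarrow> 'n \<Rightarrow> ('n::finite) gl" where
  "E i j = (\<chi> k l. if k = i \<and> l = j then 1 else 0)"

lemma clinear_trace: "clinear (trace :: ('n::finite) gl \<Rightarrow> complex)"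
  by (simp add: clinear_iff trace_def scaleC_vec_def scaleC_complex_def sum.distrib sum_distrib_left)

typedef 'n sl = "{A :: ('n::finite) gl. trace A = 0}"
  by (rule exI[of _ 0]) (simp add: trace_def)

setup_lifting type_definition_sl

instantiation sl :: (finite) complex_vector
begin
lift_definition zero_sl :: "'a sl" is 0 by (simp add: clinear_0[OF clinear_trace])
lift_definition plus_sl :: "'a sl \<Rightarrow> 'a sl \<Rightarrow> 'a sl" is "(+)" by (simp add: trace_add)
lift_definition minus_sl :: "'a sl \<Rightarrow> 'a sl \<Rightarrow> 'a sl" is "(-)" by (simp add: trace_sub)
lift_definition uminus_sl :: "'a sl \<Rightarrow> 'a sl" is uminus
  by (simp add: trace_def sum_negf)
lift_definition scaleC_sl :: "complex \<Rightarrow> 'a sl \<Rightarrow> 'a sl" is scaleC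
  by (simp add: clinear_scale[OF clinear_trace])
instance by (standard; transfer)
  (simp_all add: scaleC_add_right scaleC_add_left scaleC_scaleC scaleC_one)
end

lemma clinear_Rep_sl: "clinear Rep_sl"
  by (simp add: clinear_iff plus_sl.rep_eq scaleC_sl.rep_eq)

lemma matrix_scaleC_left: "(c *\<^sub>C A) ** B = c *\<^sub>C (A ** B)" for A B :: "('n::finite) gl"
  by (simp add: matrix_matrix_mult_def scaleC_vec_def scaleC_complex_def vec_eq_iff sum_distrib_left mult_ac)

lemma matrix_scaleC_right: "A ** (c *\<^sub>C B) = c *\<^sub>C (A ** B)" for A B :: "('n::finite) gl"
  by (simp add: matrix_matrix_mult_def scaleC_vec_def scaleC_complex_def vec_eq_iff sum_distrib_left mult_ac)

lemma clinear_matrix_mult: "clinear (\<lambda>X :: 'n gl. A ** X)" for A :: "('n::finite) gl"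
  by (rule clinearI) (simp_all add: matrix_add_ldistrib matrix_scaleC_right)

lift_definition bracket :: "('n::finite) sl \<Rightarrow> 'n sl \<Rightarrow> 'n sl" is "\<lambda>X Y. X ** Y - Y ** X"
  subgoal for X Y by (simp add: trace_sub trace_mul_sym[of X Y])
  done

lift_definition ad :: "('n::finite) sl \<Rightarrow> 'n sl endo" is "\<lambda>x y. bracket x y"
proof (rule clinearI)
  fix x y z :: "'n sl" and c
  show "bracket x (y + z) = bracket x y + bracket x z"
    by transfer (simp add: matrix_matrix_mult_def vec_eq_iff distrib_left distrib_right sum.distrib)
  show "bracket x (c *\<^sub>C y) = c *\<^sub>C bracket x y"
    by transfer
      (simp add: matrix_scaleC_left matrix_scaleC_right complex_vector.scale_right_diff_distrib)
qed

text \<open>The linear extension of the formula given on the matrix units.\<close>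

definition delta_gl :: "('n::finite) gl \<Rightarrow> ('n gl, 'n gl) tensor" where
  "delta_gl A = (\<Sum>i\<in>UNIV. \<Sum>j\<in>UNIV. A $ i $ j *\<^sub>C
     ((1 / (2 * of_nat CARD('n))) *\<^sub>C (\<Sum>k\<in>UNIV. E i k \<otimes> E k j - E k j \<otimes> E i k)))"

text \<open>
  \<open>delta x\<close> is the element of \<open>sl\<^sub>n \<otimes> sl\<^sub>n\<close> whose image under the injection
  \<open>sl\<^sub>n \<otimes> sl\<^sub>n \<rightarrow> gl\<^sub>n \<otimes> gl\<^sub>n\<close> induced by the inclusion is \<open>delta_gl x\<close>;
  existence and uniqueness are proved in \<open>delta_ex1\<close>.
\<close>

definition delta :: "('n::finite) sl \<Rightarrow> ('n sl, 'n sl) tensor" where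
  "delta x = (THE t. tensor_map Rep_sl Rep_sl t = delta_gl (Rep_sl x))"

text \<open>The projection of \<open>gl\<^sub>n = sl\<^sub>n \<oplus> \<complex>I\<close> onto \<open>sl\<^sub>n\<close>.\<close>

lift_definition sl_proj :: "('n::finite) gl \<Rightarrow> 'n sl"
  is "\<lambda>A. A - (trace A / of_nat CARD('n)) *\<^sub>C mat 1"
  by (simp add: trace_sub clinear_scale[OF clinear_trace] trace_I scaleC_complex_def)

lemma clinear_sl_proj: "clinear sl_proj"
  unfolding clinear_iff
  by (intro conjI allI; transfer)
    (simp_all add: trace_add clinear_scale[OF clinear_trace] add_divide_distrib scaleC_add_left
      scaleC_complex_def scaleC_scaleC complex_vector.scale_right_diff_distrib)

lemma sl_proj_Rep_sl [simp]: "sl_proj (Rep_sl x) = x"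
  by transfer simp

lemma sl_proj_I [simp]: "sl_proj (mat 1) = 0"
  by transfer (simp add: trace_I scaleC_one)

lemma delta_ex1: "\<exists>!t. tensor_map Rep_sl Rep_sl t = delta_gl (Rep_sl (x :: ('n::finite) sl))"
proof
  let ?i = "Rep_sl :: 'n sl \<Rightarrow> _" and ?p = "sl_proj :: _ \<Rightarrow> 'n sl"
  note ii = tensor_map[OF clinear_Rep_sl clinear_Rep_sl]
  note pp = tensor_map[OF clinear_sl_proj clinear_sl_proj]
  have left: "tensor_map ?p ?p (tensor_map ?i ?i t) = t" for t
  proof (rule tensor_ext[where G = "\<lambda>t. t"])
    show "clinear (\<lambda>t. tensor_map ?p ?p (tensor_map ?i ?i t))"
      by (rule clinear_compose[OF pp(1) ii(1)])
  qed (simp_all add: ii(2) pp(2) clinear_iff[of "\<lambda>t. t"])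
  {
    fix t assume "tensor_map ?i ?i t = delta_gl (Rep_sl x)"
    then show "t = tensor_map ?p ?p (delta_gl (Rep_sl x))" using left[of t] by simp
  }
  let ?R = "tensor_map ?i ?i" and ?P = "tensor_map ?p ?p"
  have lin: "clinear (\<lambda>t. ?R (?P t))"
    by (rule clinear_compose[OF ii(1) pp(1)])
  note bl = clinear_add[OF clinear_tensor(1)]
     clinear_diff[OF clinear_tensor(1)] clinear_scale[OF clinear_tensor(1)]
     clinear_add[OF clinear_tensor(2)] clinear_diff[OF clinear_tensor(2)] clinear_scale[OF clinear_tensor(2)]
  define n where "n = (of_nat CARD('n) :: complex)"
  have tr: "trace (E i j :: 'n gl) = (if i = j then 1 else 0)" for i j
  proof -
    have "trace (E i j :: 'n gl) = (\<Sum>k\<in>UNIV. if k = i then (if i = j then 1 else 0) else 0)"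
      unfolding trace_def E_def by (rule sum.cong) auto
    then show ?thesis by simp
  qed
  have pE: "?i (?p (E i j)) = E i j - (if i = j then 1 / n else 0) *\<^sub>C mat 1" for i j
    by (simp add: sl_proj.rep_eq tr n_def)
  have if_sum: "(\<Sum>k\<in>UNIV. (if i = k then c else 0) *\<^sub>C (f k :: ('n gl, 'n gl) tensor)) = c *\<^sub>C f i"
     "(\<Sum>k\<in>UNIV. (if k = i then c else 0) *\<^sub>C f k) = c *\<^sub>C f i" for i :: 'n and c f
    by (simp_all add: if_distrib[of "\<lambda>c. c *\<^sub>C _"] sum.delta sum.delta' cong: if_cong)
  have key: "(\<Sum>k\<in>UNIV. ?i (?p (E i k)) \<otimes> ?i (?p (E k j)) - ?i (?p (E k j)) \<otimes> ?i (?p (E i k)))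
     = (\<Sum>k\<in>UNIV. E i k \<otimes> E k j - E k j \<otimes> E i k)" for i j
    unfolding pE
    by (simp add: bl complex_vector.scale_right_diff_distrib sum_subtractf if_sum scaleC_scaleC)
      (simp add: algebra_simps)
  show "?R (?P (delta_gl (Rep_sl x))) = delta_gl (Rep_sl x)"
    unfolding delta_gl_def
    by (simp add: clinear_sum[OF lin] clinear_scale[OF lin] clinear_diff[OF lin] ii(2) pp(2) key)
qed

lemma delta: "tensor_map Rep_sl Rep_sl (delta x) = delta_gl (Rep_sl x)"
  unfolding delta_def by (rule theI'[OF delta_ex1])

lift_definition f_dual :: "'n \<Rightarrow> 'n \<Rightarrow> ('n::finite) gl dual" is "\<lambda>i j A. A $ i $ j"
  by (simp add: clinear_iff scaleC_vec_def)

lemma f_dual_E: "lin_apply (f_dual i j) (E k l) = (if i = k \<and> j = l then 1 else 0)"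
  by transfer (simp add: E_def)

text \<open>The coordinate of \<open>\<phi>\<close> at the basis element \<open>f_dual i j\<close> is \<open>\<phi> (E i j)\<close>.\<close>

definition B_gl :: "('n::finite) gl dual \<Rightarrow> 'n gl" where
  "B_gl \<phi> = (\<Sum>i\<in>UNIV. \<Sum>j\<in>UNIV. lin_apply \<phi> (E i j) *\<^sub>C E j i)"

lemma clinear_B_gl: "clinear B_gl"
  by (simp add: clinear_iff B_gl_def plus_linmap.rep_eq scaleC_linmap.rep_eq scaleC_add_left
      sum.distrib complex_vector.scale_sum_right scaleC_scaleC scaleC_complex_def)

lemma B_gl_nth: "B_gl \<phi> $ i $ j = lin_apply \<phi> (E j i)"
proof -
  have "B_gl \<phi> $ i $ j = (\<Sum>k\<in>UNIV. \<Sum>l\<in>UNIV. if k = j \<and> l = i then lin_apply \<phi> (E k l) else 0)"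
    by (auto simp: B_gl_def E_def scaleC_vec_def scaleC_complex_def intro!: sum.cong)
  also have "\<dots> = (\<Sum>k\<in>UNIV. if k = j then (\<Sum>l\<in>UNIV. if l = i then lin_apply \<phi> (E k l) else 0) else 0)"
    by (intro sum.cong) auto
  finally show ?thesis by simp
qed

lemma B_gl_f_dual: "B_gl (f_dual i j) = E j i"
  by (auto simp: vec_eq_iff B_gl_nth f_dual_E) (auto simp: E_def)

text \<open>Extension of a functional from \<open>sl\<^sub>n\<close> to \<open>gl\<^sub>n\<close> by zero on the identity matrix.\<close>

lift_definition dual_ext :: "('n::finite) sl dual \<Rightarrow> 'n gl dual" is "\<lambda>\<phi> A. \<phi> (sl_proj A)"
  by (rule clinear_compose[OF _ clinear_sl_proj])

lemma trace_B_gl: "trace (B_gl \<phi>) = lin_apply \<phi> (mat 1)"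
proof -
  have "mat 1 = (\<Sum>i\<in>UNIV. E i i :: 'a gl)"
    by (auto simp: vec_eq_iff mat_def E_def intro!: sum.neutral)
  then show ?thesis
    by (simp add: trace_def B_gl_nth clinear_sum[OF clinear_lin_apply])
qed

lift_definition B :: "('n::finite) sl dual \<Rightarrow> 'n sl" is "\<lambda>\<phi>. B_gl (dual_ext \<phi>)"
  by (simp add: trace_B_gl dual_ext.rep_eq clinear_0[OF clinear_lin_apply])

lemma gl_expand: "A = (\<Sum>i\<in>UNIV. \<Sum>j\<in>UNIV. A $ i $ j *\<^sub>C E i j)" for A :: "('n::finite) gl"
proof -
  have "(\<Sum>i\<in>UNIV. \<Sum>j\<in>UNIV. A $ i $ j *\<^sub>C E i j) $ k $ l = A $ k $ l" for k l
  proof -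
    have "(\<Sum>i\<in>UNIV. \<Sum>j\<in>UNIV. A $ i $ j *\<^sub>C E i j) $ k $ l
        = (\<Sum>i\<in>UNIV. \<Sum>j\<in>UNIV. if i = k \<and> j = l then A $ i $ j else 0)"
      by (auto simp: E_def scaleC_vec_def scaleC_complex_def intro!: sum.cong)
    also have "\<dots> = (\<Sum>i\<in>UNIV. if i = k then (\<Sum>j\<in>UNIV. if j = l then A $ i $ j else 0) else 0)"
      by (intro sum.cong) auto
    finally show ?thesis by simp
  qed
  then show ?thesis by (simp add: vec_eq_iff)
qed

lift_definition trace_form :: "('n::finite) sl \<Rightarrow> 'n sl dual"
  is "\<lambda>x y. trace (Rep_sl x ** Rep_sl y)"
  by (rule clinearI)
    (simp_all add: plus_sl.rep_eq scaleC_sl.rep_eq matrix_add_ldistrib trace_add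
      matrix_scaleC_right clinear_scale[OF clinear_trace])

lemma trace_B_gl_mult: "trace (B_gl \<psi> ** A) = lin_apply \<psi> A"
proof -
  have "trace (B_gl \<psi> ** A) = (\<Sum>i\<in>UNIV. \<Sum>j\<in>UNIV. lin_apply \<psi> (E j i) * A $ j $ i)"
    by (simp add: trace_def matrix_matrix_mult_def B_gl_nth)
  also have "\<dots> = (\<Sum>j\<in>UNIV. \<Sum>i\<in>UNIV. A $ j $ i * lin_apply \<psi> (E j i))"
    by (subst sum.swap) (simp add: mult.commute)
  also have "\<dots> = lin_apply \<psi> A"
    by (subst (2) gl_expand[of A])
      (simp add: clinear_sum[OF clinear_lin_apply] clinear_scale[OF clinear_lin_apply] scaleC_complex_def)
  finally show ?thesis .
qed

lemma trace_form_B: "trace_form (B \<phi>) = \<phi>"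
proof -
  have "lin_apply (trace_form (B \<phi>)) y = lin_apply \<phi> y" for y
    by (simp add: trace_form.rep_eq B.rep_eq trace_B_gl_mult dual_ext.rep_eq)
  then show ?thesis by (simp add: lin_apply_inject[symmetric] fun_eq_iff)
qed

lemma trace_form_ext: "lin_apply (dual_ext (trace_form x)) A = trace (Rep_sl x ** A)"
proof -
  have "trace (Rep_sl x) = 0" using Rep_sl[of x] by simp
  then show ?thesis
    by (simp add: dual_ext.rep_eq trace_form.rep_eq sl_proj.rep_eq clinear_trace[THEN clinear_scale]
        matrix_scaleC_right clinear_diff[OF clinear_matrix_mult] trace_sub scaleC_complex_def)
qed

lemma trace_mult_E: "trace (A ** E j i) = A $ i $ j"
proof -
  have "trace (A ** E j i) = (\<Sum>k\<in>UNIV. \<Sum>l\<in>UNIV. if k = i \<and> l = j then A $ k $ l else 0)"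
    by (auto simp: trace_def matrix_matrix_mult_def E_def intro!: sum.cong)
  also have "\<dots> = (\<Sum>k\<in>UNIV. if k = i then (\<Sum>l\<in>UNIV. if l = j then A $ k $ l else 0) else 0)"
    by (intro sum.cong) auto
  finally have "trace (A ** E j i) = \<dots>" .
  then show ?thesis by simp
qed

lemma B_trace_form: "B (trace_form x) = x"
proof -
  have "Rep_sl (B (trace_form x)) = Rep_sl x"
    by (simp add: B.rep_eq vec_eq_iff B_gl_nth trace_form_ext trace_mult_E)
  then show ?thesis by (simp add: Rep_sl_inject)
qed

lemma bij_B: "bij B"
  by (rule o_bij[of trace_form]) (auto simp: fun_eq_iff trace_form_B B_trace_form)

end

theory Submission
  imports Defs
begin

text \<open>
  The inverse of \<open>B\<close> is \<open>trace_form\<close>, the map \<open>x \<mapsto> tr (x \<cdot>)\<close>, so \<open>\<eta> \<circ> (id \<otimes> B\<^sup>-\<^sup>1)\<close> sends \<open>a \<otimes> b\<close>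
  to the endomorphism \<open>y \<mapsto> tr (b y) a\<close>. This formula makes sense on all of \<open>gl\<^sub>n \<otimes> gl\<^sub>n\<close>, where
  \<open>\<delta>\<close> is given explicitly, so the comparison with \<open>ad\<close> is made there: \<open>contract_gl y\<close> contracts
  a tensor against \<open>y\<close>, and on \<open>sl\<^sub>n \<otimes> sl\<^sub>n\<close> it is the map above evaluated at \<open>y\<close>
  (\<open>Rep_sl_eta_tensor_map\<close>).

  On a matrix unit the identity is the pair of expansions
  \<open>E\<^sub>i\<^sub>j y = \<Sum>\<^sub>k tr (E\<^sub>k\<^sub>j y) E\<^sub>i\<^sub>k\<close> and \<open>y E\<^sub>i\<^sub>j = \<Sum>\<^sub>k tr (E\<^sub>i\<^sub>k y) E\<^sub>k\<^sub>j\<close>, whose right-hand sides are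
  the contractions of the two halves of \<open>2n \<delta>(E\<^sub>i\<^sub>j)\<close> (\<open>E_mult\<close>, \<open>mult_E\<close>). The difference of the
  left-hand sides is the commutator, and linearity in the matrix gives the general case
  (\<open>contract_delta_gl\<close>).
\<close>

definition contract_gl :: "('n::finite) gl \<Rightarrow> ('n gl, 'n gl) tensor \<Rightarrow> 'n gl" where
  "contract_gl y = tensor_lift (\<lambda>a b. trace (b ** y) *\<^sub>C a)"

lemma clinear_matrix_mult_right: "clinear (\<lambda>X :: 'n gl. X ** A)" for A :: "('n::finite) gl"
  by (rule clinearI)
    (simp add: matrix_matrix_mult_def vec_eq_iff distrib_right sum.distrib, rule matrix_scaleC_left)

lemma cbilinear_contract_gl:
  "cbilinear (\<lambda>a b. trace (b ** y) *\<^sub>C a)" for y :: "('n::finite) gl"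
  unfolding cbilinear_def clinear_iff
  by (simp add: clinear_add[OF clinear_matrix_mult_right] matrix_scaleC_left trace_add
      clinear_scale[OF clinear_trace] scaleC_add_left scaleC_add_right scaleC_scaleC
      scaleC_complex_def mult.commute)

lemma clinear_contract_gl: "clinear (contract_gl y)"
  and contract_gl_tensor: "contract_gl y (a \<otimes> b) = trace (b ** y) *\<^sub>C a"
  unfolding contract_gl_def by (rule tensor_lift[OF cbilinear_contract_gl])+

text \<open>
  Multiplication by \<open>E i j\<close> on the left moves row \<open>j\<close> of \<open>y\<close> to row \<open>i\<close>, and the trace reads off
  the entry of \<open>y\<close> at \<open>(j, k)\<close>. It is written as a trace because that is what contracting
  \<open>E i k \<otimes> E k j\<close> against \<open>y\<close> produces.
\<close>

lemma E_mult: "E i j ** y = (\<Sum>k\<in>UNIV. trace (E k j ** y) *\<^sub>C E i k)" for y :: "('n::finite) gl"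
proof -
  have "(E i j ** y) $ p $ q = (if p = i then y $ j $ q else 0)" for p q
    by (simp add: matrix_matrix_mult_def E_def if_distrib[of "\<lambda>c. c * _"] cong: if_cong)
  moreover have "(\<Sum>k\<in>UNIV. y $ j $ k *\<^sub>C E i k) $ p $ q = (if p = i then y $ j $ q else 0)" for p q
    by (simp add: E_def scaleC_vec_def scaleC_complex_def if_distrib[of "\<lambda>c. _ * c"] cong: if_cong)
  ultimately show ?thesis
    by (simp add: vec_eq_iff trace_mul_sym[of "E k l" y for k l] trace_mult_E)
qed

text \<open>
  The counterpart for columns: column \<open>i\<close> of \<open>y\<close> moves to column \<open>j\<close>, and the terms are the
  contractions of \<open>E k j \<otimes> E i k\<close>.
\<close>

lemma mult_E: "y ** E i j = (\<Sum>k\<in>UNIV. trace (E i k ** y) *\<^sub>C E k j)" for y :: "('n::finite) gl"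
proof -
  have "(y ** E i j) $ p $ q = (if q = j then y $ p $ i else 0)" for p q
    by (simp add: matrix_matrix_mult_def E_def if_distrib[of "\<lambda>c. _ * c"] cong: if_cong)
  moreover have "(\<Sum>k\<in>UNIV. y $ k $ i *\<^sub>C E k j) $ p $ q = (if q = j then y $ p $ i else 0)" for p q
    by (simp add: E_def scaleC_vec_def scaleC_complex_def if_distrib[of "\<lambda>c. _ * c"] cong: if_cong)
  ultimately show ?thesis
    by (simp add: vec_eq_iff trace_mul_sym[of "E k l" y for k l] trace_mult_E)
qed

text \<open>
  The theorem carried over to \<open>gl\<^sub>n\<close>; the factor \<open>2n\<close> cancels the normalisation of \<open>\<delta>\<close>.
\<close>

lemma contract_delta_gl:
  "(2 * of_nat CARD('n)) *\<^sub>C contract_gl y (delta_gl A) = A ** y - y ** A"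
  for A y :: "('n::finite) gl"
proof -
  note linear = clinear_sum[OF clinear_contract_gl] clinear_scale[OF clinear_contract_gl]
    clinear_diff[OF clinear_contract_gl] contract_gl_tensor
  have unit: "(\<Sum>k\<in>UNIV. contract_gl y (E i k \<otimes> E k j - E k j \<otimes> E i k)) = E i j ** y - y ** E i j"
    for i j
    by (simp add: linear E_mult[of i j y] mult_E[of y i j] sum_subtractf)
  have "(2 * of_nat CARD('n)) *\<^sub>C contract_gl y (delta_gl A)
      = (\<Sum>i\<in>UNIV. \<Sum>j\<in>UNIV. A $ i $ j *\<^sub>C (E i j ** y - y ** E i j))"
    unfolding delta_gl_def linear(1,2) unit
    by (simp add: complex_vector.scale_sum_right scaleC_scaleC)
  also have "\<dots> = (\<Sum>i\<in>UNIV. \<Sum>j\<in>UNIV. A $ i $ j *\<^sub>C E i j) ** y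
      - y ** (\<Sum>i\<in>UNIV. \<Sum>j\<in>UNIV. A $ i $ j *\<^sub>C E i j)"
    by (simp add: clinear_sum[OF clinear_matrix_mult] clinear_sum[OF clinear_matrix_mult_right]
        matrix_scaleC_left matrix_scaleC_right complex_vector.scale_right_diff_distrib sum_subtractf)
  finally show ?thesis
    by (simp flip: gl_expand)
qed

lemma clinear_trace_form: "clinear trace_form"
  by (rule clinearI; transfer)
    (simp_all add: fun_eq_iff plus_sl.rep_eq scaleC_sl.rep_eq matrix_scaleC_left trace_add
      clinear_add[OF clinear_matrix_mult_right] clinear_scale[OF clinear_trace])

lemma inv_B: "inv B = trace_form"
  by (rule inv_unique_comp) (simp_all add: fun_eq_iff B_trace_form trace_form_B)

lemma clinear_id: "clinear id"
  by (simp add: clinear_iff)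

text \<open>
  This transfers the computation from \<open>gl\<^sub>n\<close> back to \<open>sl\<^sub>n\<close>. The element \<open>delta x\<close> is known only
  through its image under \<open>tensor_map Rep_sl Rep_sl\<close>, and the right-hand side depends on \<open>t\<close>
  through that image alone. Both sides are linear in \<open>t\<close>, and on \<open>a \<otimes> b\<close> both give
  \<open>tr (b y) a\<close>.
\<close>

lemma Rep_sl_eta_tensor_map:
  "Rep_sl (lin_apply (eta (tensor_map id trace_form t)) y)
    = contract_gl (Rep_sl y) (tensor_map Rep_sl Rep_sl t)"
proof (rule tensor_ext[of _ _ t])
  have eval: "clinear (\<lambda>f. lin_apply f y)" for y :: "'a sl"
    by (simp add: clinear_iff plus_linmap.rep_eq scaleC_linmap.rep_eq)
  have eta: "clinear (eta :: ('a sl, 'a sl dual) tensor \<Rightarrow> _)"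
    unfolding eta_def by (rule clinear_tensor_lift[OF cbilinear_rank_one])
  show "clinear (\<lambda>t. Rep_sl (lin_apply (eta (tensor_map id trace_form t)) y))"
    by (intro clinear_compose[OF clinear_Rep_sl] clinear_compose[OF eval] clinear_compose[OF eta]
        clinear_tensor_map[OF clinear_id clinear_trace_form])
  show "clinear (\<lambda>t. contract_gl (Rep_sl y) (tensor_map Rep_sl Rep_sl t))"
    by (rule clinear_compose[OF clinear_contract_gl clinear_tensor_map[OF clinear_Rep_sl clinear_Rep_sl]])
  show "Rep_sl (lin_apply (eta (tensor_map id trace_form (a \<otimes> b))) y)
    = contract_gl (Rep_sl y) (tensor_map Rep_sl Rep_sl (a \<otimes> b))" for a b
    by (simp add: tensor_map_tensor clinear_id clinear_trace_form clinear_Rep_sl contract_gl_tensor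
        eta_def tensor_lift_tensor[OF cbilinear_rank_one] rank_one.rep_eq scaleC_sl.rep_eq
        trace_form.rep_eq)
qed

theorem theorem5p3:
  assumes "CARD('n::finite) \<ge> 2"
  shows "(ad :: 'n sl \<Rightarrow> 'n sl endo) =
    (\<lambda>x. (2 * of_nat CARD('n)) *\<^sub>C (eta \<circ> tensor_map id (inv B) \<circ> delta) x)"
proof -
  have "Rep_sl (lin_apply (ad x) y)
      = Rep_sl (lin_apply ((2 * of_nat CARD('n)) *\<^sub>C eta (tensor_map id (inv B) (delta x))) y)"
    for x y :: "'n sl"
    by (simp add: ad.rep_eq bracket.rep_eq scaleC_linmap.rep_eq scaleC_sl.rep_eq inv_B
        Rep_sl_eta_tensor_map delta contract_delta_gl)
  then show ?thesis
    by (simp add: Rep_sl_inject lin_apply_inject[symmetric] fun_eq_iff)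
qed

end
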